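(* For all $m\ge 5$, $$A(\max\Gamma_{3,m,1})=\frac{m}{44}\left(-25t_m+48t_{m-1}+31t_{m-2}\right)+\frac{1}{44}\left(173t_m-294t_{m-1}-213t_{m-2}\right)+\frac{m+11}{4},$$ $$A(\max\Gamma_{2,m,1})=\frac{m}{44}\left(-5t_m+36t_{m-1}-7t_{m-2}\right)+\frac{1}{22}\left(-8t_m-69t_{m-1}+59t_{m-2}\right)+\frac{m+10}{4},$$ $$A(\max\Gamma_{1,m,1})=\frac{m}{44}\left(3t_m+18t_{m-1}+13t_{m-2}\right)+\frac{1}{44}\left(3t_m-102t_{m-1}-51t_{m-2}\right)+\frac{m+9}{4}.$$
   Context: The Tribonacci sequence $\mathbb{T}$ is the fixed point beginning with $a$ of the substitution $\sigma(a)=ab,\ \sigma(b)=ac,\ \sigma(c)=a$; positions are numbered from $1$ and $\mathbb{T}[1,n]$ is the prefix of length $n$. For a nonempty factor $\omega$ of $\mathbb{T}$, $\omega_p$ denotes its $p$-th occurrence. The word $\omega_p\omega_{p+1}$ is a (repeated) square if $\omega_{p+1}$ begins immediately after $\omega_p$ ends. $A(n)$ is the number of pairs $(\omega,p)$ such that $\omega_p\omega_{p+1}$ is a square contained in $\mathbb{T}[1,n]$, i.e. ending at a position $\le n$. The Tribonacci numbers are $t_m=|\sigma^m(a)|$ for $m\ge 0$ ($t_0=1,t_1=2,t_2=4,t_3=7$, $t_m=t_{m-1}+t_{m-2}+t_{m-3}$). For $m\ge 4$ define the sets of consecutive integers $$\Gamma_{1,m,1}=\left\{\tfrac{t_m+2t_{m-1}-t_{m-2}-1}{2},\dots,\tfrac{t_m+2t_{m-1}+t_{m-2}-3}{2}\right\},$$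 $$\Gamma_{2,m,1}=\left\{\tfrac{-t_m+4t_{m-1}+t_{m-2}-1}{2},\dots,\tfrac{t_m+2t_{m-1}-t_{m-2}-3}{2}\right\},$$ $$\Gamma_{3,m,1}=\left\{\tfrac{t_m+t_{m-2}-1}{2},\dots,\tfrac{-t_m+4t_{m-1}+t_{m-2}-3}{2}\right\}.$$ *)

theory Defs
  imports Complex_Main "HOL-Library.Stream" "HOL-Library.Infinite_Set"
begin

datatype letter = La | Lb | Lc

fun sigma :: "letter \<Rightarrow> letter list" where
  "sigma La = [La, Lb]"
| "sigma Lb = [La, Lc]"
| "sigma Lc = [La]"

definition sigma_word :: "letter list \<Rightarrow> letter list" where
  "sigma_word w = concat (map sigma w)"

definition sigma_stream :: "letter stream \<Rightarrow> letter stream" where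
  "sigma_stream s = flat (smap sigma s)"

text \<open>The description is proper: see \<open>tribonacci_ex1\<close> below.\<close>

definition tribonacci :: "letter stream" where
  "tribonacci = (THE s. shd s = La \<and> sigma_stream s = s)"

definition trib :: "nat \<Rightarrow> nat" where
  "trib m = length ((sigma_word ^^ m) [La])"

text \<open>Positions are numbered from 1, streams from 0.\<close>

definition occurrences :: "letter list \<Rightarrow> nat set" where
  "occurrences w = {i. i \<ge> 1 \<and> stake (length w) (sdrop (i - 1) tribonacci) = w}"

definition is_factor :: "letter list \<Rightarrow> bool" where
  "is_factor w \<longleftrightarrow> occurrences w \<noteq> {}"

text \<open>The starting position of the \<open>p\<close>-th occurrence, for \<open>p \<ge> 1\<close>. Since \<open>enumerate\<close> is only
  meaningful on infinite sets, this relies on \<open>infinite_occurrences\<close> below.\<close>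

definition occ :: "letter list \<Rightarrow> nat \<Rightarrow> nat" where
  "occ w p = enumerate (occurrences w) (p - 1)"

definition is_square_at :: "letter list \<Rightarrow> nat \<Rightarrow> bool" where
  "is_square_at w p \<longleftrightarrow> occ w (p + 1) = occ w p + length w"

definition num_squares :: "nat \<Rightarrow> nat" where
  "num_squares n = card {(w, p). w \<noteq> [] \<and> is_factor w \<and> p \<ge> 1 \<and> is_square_at w p \<and>
     occ w (p + 1) + length w - 1 \<le> n}"

text \<open>For \<open>m \<ge> 2\<close> all the divisions by 2 are exact: see \<open>Gamma_even\<close> below.\<close>

definition Gamma1 :: "nat \<Rightarrow> int set" where
  "Gamma1 m = (let t = (\<lambda>k. int (trib k)) in
     {(t m + 2 * t (m - 1) - t (m - 2) - 1) div 2 .. (t m + 2 * t (m - 1) + t (m - 2) - 3) div 2})"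

definition Gamma2 :: "nat \<Rightarrow> int set" where
  "Gamma2 m = (let t = (\<lambda>k. int (trib k)) in
     {(- t m + 4 * t (m - 1) + t (m - 2) - 1) div 2 .. (t m + 2 * t (m - 1) - t (m - 2) - 3) div 2})"

definition Gamma3 :: "nat \<Rightarrow> int set" where
  "Gamma3 m = (let t = (\<lambda>k. int (trib k)) in
     {(t m + t (m - 2) - 1) div 2 .. (- t m + 4 * t (m - 1) + t (m - 2) - 3) div 2})"

lemma sigma_nonempty [simp]: "sigma x \<noteq> []"
  by (cases x) auto

lemma sigma_word_append [simp]: "sigma_word (u @ v) = sigma_word u @ sigma_word v"
  by (simp add: sigma_word_def)

lemma sigma_word_pow_append [simp]:
  "(sigma_word ^^ n) (u @ v) = (sigma_word ^^ n) u @ (sigma_word ^^ n) v"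
  by (induction n) auto

lemma sigma_stream_shift: "sigma_stream (u @- s) = sigma_word u @- sigma_stream s"
  unfolding sigma_stream_def sigma_word_def by (induction u) auto

abbreviation iter_a :: "nat \<Rightarrow> letter list" where
  "iter_a n \<equiv> (sigma_word ^^ n) [La]"

lemma iter_Suc_a: "iter_a (Suc n) = iter_a n @ (sigma_word ^^ n) [Lb]"
proof -
  have "iter_a (Suc n) = (sigma_word ^^ n) ([La] @ [Lb])"
    by (simp add: funpow_swap1 sigma_word_def)
  then show ?thesis by (simp only: sigma_word_pow_append)
qed

lemma iter_Suc_b: "(sigma_word ^^ Suc n) [Lb] = iter_a n @ (sigma_word ^^ n) [Lc]"
proof -
  have "(sigma_word ^^ Suc n) [Lb] = (sigma_word ^^ n) ([La] @ [Lc])"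
    by (simp add: funpow_swap1 sigma_word_def)
  then show ?thesis by (simp only: sigma_word_pow_append)
qed

lemma iter_Suc_c: "(sigma_word ^^ Suc n) [Lc] = iter_a n"
  by (simp add: funpow_swap1 sigma_word_def)

lemma sigma_word_eq_Nil_iff [simp]: "sigma_word u = [] \<longleftrightarrow> u = []"
  by (cases u) (auto simp: sigma_word_def)

lemma iter_nonempty: "u \<noteq> [] \<Longrightarrow> (sigma_word ^^ n) u \<noteq> []"
  by (induction n) auto

lemma length_iter_a: "n < length (iter_a n)"
proof (induction n)
  case (Suc n)
  have "length ((sigma_word ^^ n) [Lb]) > 0" by (metis iter_nonempty length_greater_0_conv list.distinct(1))
  moreover have "length (iter_a (Suc n)) = length (iter_a n) + length ((sigma_word ^^ n) [Lb])"
    by (metis iter_Suc_a length_append)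
  ultimately show ?case using Suc by linarith
qed simp

lemma iter_a_prefix: "n \<le> k \<Longrightarrow> \<exists>v. iter_a k = iter_a n @ v"
proof (induction rule: dec_induct)
  case (step k)
  then obtain v where "iter_a k = iter_a n @ v" by blast
  then show ?case by (metis append.assoc iter_Suc_a)
qed simp

lemma fixpoint_prefix:
  assumes "shd s = La" "sigma_stream s = s"
  shows "\<exists>r. s = iter_a n @- r"
proof (induction n)
  case 0
  have "s = [La] @- stl s" using assms(1) by (metis shift.simps stream.collapse)
  then show ?case by auto
next
  case (Suc n)
  then obtain r where "s = iter_a n @- r" by blast
  then have "s = iter_a (Suc n) @- sigma_stream r"
    using assms(2) by (metis sigma_stream_shift funpow.simps(2) o_apply)
  then show ?case by blast
qed

lemma iter_a_nth: "n \<le> k \<Longrightarrow> i < length (iter_a n) \<Longrightarrow> iter_a k ! i = iter_a n ! i"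
  using iter_a_prefix[of n k] by (auto simp: nth_append)

lemma tribonacci_ex1: "\<exists>!s. shd s = La \<and> sigma_stream s = s"
proof (rule ex_ex1I)
  define T where "T = smap (\<lambda>i. iter_a i ! i) nats"
  have T_nth: "T !! i = iter_a n ! i" if "i < length (iter_a n)" for i n
  proof -
    have "T !! i = iter_a i ! i" by (simp add: T_def)
    also have "\<dots> = iter_a n ! i"
      using iter_a_nth[of i n i] iter_a_nth[of n i i] length_iter_a[of i] that
      by (cases "i \<le> n") auto
    finally show ?thesis .
  qed
  have prefix: "T = iter_a n @- sdrop (length (iter_a n)) T" for n
  proof -
    have "stake (length (iter_a n)) T = iter_a n"
      by (rule nth_equalityI) (auto simp: T_nth)
    then show ?thesis by (metis stake_sdrop)
  qed
  have "sigma_stream T !! i = T !! i" for i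
  proof -
    have i: "i < length (iter_a (Suc i))" using length_iter_a[of "Suc i"] by linarith
    have "sigma_stream T = iter_a (Suc i) @- sigma_stream (sdrop (length (iter_a i)) T)"
      using prefix[of i] by (metis sigma_stream_shift funpow.simps(2) o_apply)
    then have "sigma_stream T !! i = iter_a (Suc i) ! i"
      using i by (metis shift_snth_less)
    also have "\<dots> = T !! i" using i by (metis T_nth)
    finally show ?thesis .
  qed
  then have "sigma_stream T = T" by (metis smap_alt stream.map_id)
  moreover have "shd T = La" using T_nth[of 0 0] by simp
  ultimately show "\<exists>s. shd s = La \<and> sigma_stream s = s" by blast
next
  fix s s'
  assume s: "shd s = La \<and> sigma_stream s = s" and s': "shd s' = La \<and> sigma_stream s' = s'"
  have "s !! i = s' !! i" for i
  proof -
    obtain r r' where "s = iter_a i @- r" "s' = iter_a i @- r'"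
      using s s' fixpoint_prefix by meson
    then show ?thesis using length_iter_a[of i] by (metis shift_snth_less)
  qed
  then show "s = s'" by (metis smap_alt stream.map_id)
qed

lemma tribonacci_fixpoint: "shd tribonacci = La" "sigma_stream tribonacci = tribonacci"
  using theI'[OF tribonacci_ex1] unfolding tribonacci_def by auto

lemma infinite_occurrences:
  assumes "is_factor w"
  shows "infinite (occurrences w)"
proof -
  obtain i where i: "i \<ge> 1" "stake (length w) (sdrop (i - 1) tribonacci) = w"
    using assms by (auto simp: is_factor_def occurrences_def)
  define n where "n = i - 1 + length w"
  have "\<exists>j>k. j \<in> occurrences w" for k
  proof -
    define N where "N = max n k"
    have "iter_a (Suc (Suc N)) = iter_a (Suc N) @ iter_a N @ (sigma_word ^^ N) [Lc]"
      by (metis iter_Suc_a iter_Suc_b)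
    then obtain r where r: "tribonacci = iter_a (Suc N) @- iter_a N @- r"
      using fixpoint_prefix[OF tribonacci_fixpoint, of "Suc (Suc N)"]
      by (metis shift_append)
    obtain r' where r': "tribonacci = iter_a N @- r'"
      using fixpoint_prefix[OF tribonacci_fixpoint] by blast
    define L where "L = length (iter_a (Suc N))"
    have nN: "n \<le> length (iter_a N)" using length_iter_a[of N] by (simp add: N_def)
    have kL: "k < L" using length_iter_a[of "Suc N"] by (simp add: N_def L_def)
    have shift: "tribonacci !! (L + x) = tribonacci !! x" if "x < n" for x
    proof -
      have "tribonacci !! (L + x) = (iter_a N @- r) !! x"
        using r by (metis L_def shift_snth_ge le_add1 add_diff_cancel_left')
      also have "\<dots> = tribonacci !! x"
        using nN that r' by (metis shift_snth_less order_less_le_trans)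
      finally show ?thesis .
    qed
    have "stake (length w) (sdrop (L + i - 1) tribonacci)
        = stake (length w) (sdrop (i - 1) tribonacci)"
    proof (rule nth_equalityI)
      fix y assume "y < length (stake (length w) (sdrop (L + i - 1) tribonacci))"
      then have y: "y < length w" by simp
      have "L + i - 1 + y = L + (i - 1 + y)" using i(1) by simp
      then show "stake (length w) (sdrop (L + i - 1) tribonacci) ! y
          = stake (length w) (sdrop (i - 1) tribonacci) ! y"
        using y shift[of "i - 1 + y"] by (simp add: sdrop_snth n_def add.assoc)
    qed simp
    then have "L + i \<in> occurrences w" using i by (simp add: occurrences_def)
    with kL show ?thesis by (metis trans_less_add1)
  qed
  then show ?thesis by (meson infinite_nat_iff_unbounded)
qed

lemma trib_rec: "trib (m + 3) = trib (m + 2) + trib (m + 1) + trib m"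
  using arg_cong[OF iter_Suc_a[of "Suc (Suc m)"], of length]
    arg_cong[OF iter_Suc_b[of "Suc m"], of length] arg_cong[OF iter_Suc_c[of m], of length]
  by (simp add: trib_def numeral_3_eq_3 del: funpow.simps)

lemma trib_init: "trib 0 = 1" "trib 1 = 2" "trib 2 = 4"
  by (simp_all add: trib_def sigma_word_def numeral_2_eq_2)

lemma Gamma_even:
  assumes "m \<ge> 2"
  defines "t \<equiv> \<lambda>k. int (trib k)"
  shows "even (t m + 2 * t (m - 1) - t (m - 2) - 1)" "even (t m + 2 * t (m - 1) + t (m - 2) - 3)"
    "even (- t m + 4 * t (m - 1) + t (m - 2) - 1)" "even (t m + 2 * t (m - 1) - t (m - 2) - 3)"
    "even (t m + t (m - 2) - 1)" "even (- t m + 4 * t (m - 1) + t (m - 2) - 3)"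
proof -
  have "odd (trib (k + 2) + trib k) \<and> odd (trib (k + 3) + trib (k + 1))" for k
  proof (induction k)
    case 0
    have "trib 3 = 7" using trib_rec[of 0, unfolded add_0] trib_init by linarith
    then show ?case unfolding add_0 trib_init by simp
  next
    case (Suc k)
    have idx: "Suc k + 2 = k + 3" "Suc k + 3 = k + 4" "k + 1 + 3 = k + 4" "k + 1 + 2 = k + 3"
      "k + 1 + 1 = k + 2" "Suc k + 1 = k + 2" "Suc k = k + 1" by auto
    have "trib (k + 4) = trib (k + 3) + trib (k + 2) + trib (k + 1)"
      using trib_rec[of "k + 1"] unfolding idx .
    then have "trib (k + 4) + trib (k + 2) = trib (k + 3) + trib (k + 1) + 2 * trib (k + 2)"
      by linarith
    then have "odd (trib (k + 4) + trib (k + 2))"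
      using Suc.IH by (metis even_add dvd_triv_left)
    then show ?case using Suc.IH unfolding idx by blast
  qed
  from this[of "m - 2"] have "odd (trib m + trib (m - 2))"
    using assms(1) by (metis le_add_diff_inverse2)
  then show "even (t m + 2 * t (m - 1) - t (m - 2) - 1)"
    "even (t m + 2 * t (m - 1) + t (m - 2) - 3)"
    "even (- t m + 4 * t (m - 1) + t (m - 2) - 1)" "even (t m + 2 * t (m - 1) - t (m - 2) - 3)"
    "even (t m + t (m - 2) - 1)" "even (- t m + 4 * t (m - 1) + t (m - 2) - 3)"
    unfolding t_def by auto
qed

end

theory Submission
  imports Defs
begin

text \<open>A maximal run with period \<open>p\<close> of length at least \<open>2 p - 1\<close> is the image, under an iterate of the
  substitution, of a run with period 1 that consists of a single letter: blocks that match lift to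
  letters that match, and the condition on the length survives the lifting because \<open>cc\<close> is not a
  factor. So every such run has period \<open>|sigma^k x|\<close> for a letter \<open>x\<close> and exceeds its period by
  at most \<open>t_0 + ... + t_(k-1)\<close>. This rules out fourth powers (hence squares are the same as squares formed by
  consecutive occurrences) and parametrises the squares by a level \<open>k\<close>, a letter of the word and an
  offset. The maxima of the three sets are obtained from 0, 2 and 4 by iterating
  \<open>n \<mapsto> |sigma (T[1,n])| + 1\<close>; the squares of level \<open>k\<close> contained in a prefix of such a length are
  exactly those coming from the letters of the prefix \<open>k\<close> iterations earlier.\<close>

section \<open>The substitution on positions\<close>

declare snth.simps [simp del]

abbreviation T :: "nat \<Rightarrow> letter" where
  "T i \<equiv> tribonacci !! i"

text \<open>From here on positions are numbered from 0. The image of the letter at position \<open>i\<close> under the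
  substitution starts at position \<open>phi i\<close>.\<close>

definition phi :: "nat \<Rightarrow> nat" where
  "phi i = length (sigma_word (stake i tribonacci))"

text \<open>\<open>cyc x\<close> is the letter right after the initial \<open>a\<close> of
  \<open>sigma x\<close>; for \<open>x = Lc\<close> it is the \<open>a\<close> that opens the next
  block. Being injective, it recovers a letter from one position of the image.\<close>

fun cyc :: "letter \<Rightarrow> letter" where
  "cyc La = Lb"
| "cyc Lb = Lc"
| "cyc Lc = La"

lemma inj_cyc: "inj cyc"
proof (rule injI)
  fix x y assume "cyc x = cyc y"
  then show "x = y" by (cases x; cases y) auto
qed

lemma sdrop_phi: "sdrop (phi i) tribonacci = sigma_stream (sdrop i tribonacci)"
proof -
  have "tribonacci = sigma_stream (stake i tribonacci @- sdrop i tribonacci)"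
    by (simp add: stake_sdrop tribonacci_fixpoint)
  then have "tribonacci = sigma_word (stake i tribonacci) @- sigma_stream (sdrop i tribonacci)"
    by (simp only: sigma_stream_shift)
  then have "sdrop (phi i) tribonacci =
      sdrop (phi i) (sigma_word (stake i tribonacci) @- sigma_stream (sdrop i tribonacci))"
    by (rule arg_cong)
  also have "\<dots> = sigma_stream (sdrop i tribonacci)"
    by (simp add: phi_def sdrop_shift)
  finally show ?thesis .
qed

lemma phi_0 [simp]: "phi 0 = 0"
  by (simp add: phi_def sigma_word_def)

lemma phi_Suc: "phi (Suc i) = phi i + length (sigma (T i))"
  by (simp add: phi_def stake_Suc sigma_word_def del: stake.simps)

lemma T_phi_add:
  assumes "x < length (sigma (T i))"
  shows "T (phi i + x) = sigma (T i) ! x"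
proof -
  have "sdrop i tribonacci = [T i] @- sdrop (Suc i) tribonacci"
    by (rule stream.expand) simp
  then have "sdrop (phi i) tribonacci = sigma_word [T i] @- sigma_stream (sdrop (Suc i) tribonacci)"
    using sdrop_phi sigma_stream_shift by metis
  then have "sdrop (phi i) tribonacci !! x = sigma_word [T i] ! x"
    using assms by (simp add: sigma_word_def)
  then show ?thesis by (simp add: sdrop_snth sigma_word_def)
qed

lemma T_phi: "T (phi i) = La"
  using T_phi_add[of 0 i] by (cases "T i") auto

lemma T_phi_1: "T (Suc (phi i)) = cyc (T i)"
proof (cases "T i")
  case Lc
  then have "Suc (phi i) = phi (Suc i)" by (simp add: phi_Suc)
  then show ?thesis using T_phi Lc by simp
qed (use T_phi_add[of 1 i] in auto)

text \<open>The last letter of a block depends only on the letter it comes from, so equality of the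
  letters before a run carries over to its image.\<close>

lemma T_phi_last: "T (phi (Suc i) - 1) = (case T i of La \<Rightarrow> Lb | Lb \<Rightarrow> Lc | Lc \<Rightarrow> La)"
  using T_phi_add[of 1 i] T_phi[of i] by (cases "T i") (auto simp: phi_Suc)

lemma phi_less_Suc: "phi i < phi (Suc i)"
  by (cases "T i") (auto simp: phi_Suc)

lemma strict_mono_phi: "strict_mono phi"
  by (simp add: phi_less_Suc strict_mono_Suc_iff)

lemmas phi_less_iff = strict_mono_less[OF strict_mono_phi]
lemmas phi_le_iff = strict_mono_less_eq[OF strict_mono_phi]

lemma T_0: "T 0 = La"
  using T_phi[of 0] by simp

lemma phi_cases:
  obtains (start) j where "i = phi j" | (inner) j where "i = Suc (phi j)" "T j \<noteq> Lc"
proof -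
  have "\<exists>j. i = phi j \<or> i = Suc (phi j) \<and> T j \<noteq> Lc"
  proof (induction i)
    case 0
    then show ?case by (metis phi_0)
  next
    case (Suc i)
    then obtain j where j: "i = phi j \<or> i = Suc (phi j) \<and> T j \<noteq> Lc" by blast
    have "Suc i = Suc (phi j) \<and> T j \<noteq> Lc \<or> Suc i = phi (Suc j)"
      using j by (cases "T j") (auto simp: phi_Suc)
    then show ?case by blast
  qed
  then show ?thesis using that by blast
qed

lemma T_eq_La_iff: "T i = La \<longleftrightarrow> (\<exists>j. i = phi j)"
proof
  assume "T i = La"
  then show "\<exists>j. i = phi j"
  proof (cases i rule: phi_cases)
    case (inner j)
    then show ?thesis using \<open>T i = La\<close> T_phi_1[of j] by (cases "T j") auto
  qed auto
qed (auto simp: T_phi)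

lemma T_not_La:
  assumes "T i \<noteq> La"
  shows "i > 0" "T (i - 1) = La" "T (Suc i) = La"
proof -
  obtain j where j: "i = Suc (phi j)" "T j \<noteq> Lc"
    using assms T_phi by (cases i rule: phi_cases) auto
  show "i > 0" "T (i - 1) = La" using j by (auto simp: T_phi)
  have "Suc i = phi (Suc j)" using j by (cases "T j") (auto simp: phi_Suc)
  then show "T (Suc i) = La" by (simp add: T_phi)
qed

text \<open>Of two adjacent letters at least one is \<open>a\<close>, whose image has length 2. In
  particular \<open>cc\<close> is not a factor.\<close>

lemma phi_add_2: "phi (i + 2) \<ge> phi i + 3"
proof (cases "T i = La")
  case True
  then show ?thesis using phi_less_Suc[of "Suc i"] by (auto simp: phi_Suc[of i])
next
  case False
  then have "T (Suc i) = La" by (rule T_not_La)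
  then show ?thesis using phi_less_Suc[of i] by (auto simp: phi_Suc[of "Suc i"])
qed

section \<open>Iterated images\<close>

definition len :: "nat \<Rightarrow> letter \<Rightarrow> nat" where
  "len k x = length ((sigma_word ^^ k) [x])"

lemma len_0 [simp]: "len 0 x = 1"
  by (simp add: len_def)

lemma len_La [simp]: "len k La = trib k"
  by (simp add: len_def trib_def)

lemma trib_Suc: "trib (Suc k) = trib k + len k Lb"
  using arg_cong[OF iter_Suc_a[of k], of length] by (simp add: trib_def len_def del: funpow.simps)

lemma len_Lb_Suc: "len (Suc k) Lb = trib k + len k Lc"
  using arg_cong[OF iter_Suc_b[of k], of length] by (simp add: trib_def len_def del: funpow.simps)

lemma len_Lc_Suc [simp]: "len (Suc k) Lc = trib k"
  using arg_cong[OF iter_Suc_c[of k], of length] by (simp add: trib_def len_def del: funpow.simps)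

lemma len_Lb_1 [simp]: "len (Suc 0) Lb = 2"
  using len_Lb_Suc[of 0] trib_init by simp

lemma len_Lb_Suc_Suc [simp]: "len (Suc (Suc k)) Lb = trib (Suc k) + trib k"
  using len_Lb_Suc[of "Suc k"] by simp

lemma len_pos: "len k x > 0"
  unfolding len_def by (simp add: iter_nonempty)

lemma trib_less_Suc: "trib k < trib (Suc k)"
  using len_pos by (simp add: trib_Suc)

lemma strict_mono_trib: "strict_mono trib"
  by (simp add: trib_less_Suc strict_mono_Suc_iff)

lemmas trib_less_iff = strict_mono_less[OF strict_mono_trib]
lemmas trib_le_iff = strict_mono_less_eq[OF strict_mono_trib]
lemmas trib_eq_iff = strict_mono_eq[OF strict_mono_trib]

lemma trib_pos: "trib k > 0"
  using len_pos[of k La] by simp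

lemma trib_Suc3: "trib (Suc (Suc (Suc k))) = trib (Suc (Suc k)) + trib (Suc k) + trib k"
  using trib_rec[of k] by (simp add: numeral_3_eq_3)

lemma trib_0_1_2: "trib 0 = 1" "trib (Suc 0) = 2" "trib (Suc (Suc 0)) = 4"
  using trib_init by (auto simp: numeral_2_eq_2)

text \<open>The induction splits off the innermost substitution and applies the hypothesis to the
  letters \<open>a\<close> and \<open>cyc (T j)\<close> from \<open>phi j\<close> on; the second one
  belongs to the block of \<open>T j\<close> unless \<open>T j = Lc\<close>.\<close>

lemma phi_pow_Suc: "(phi ^^ k) (Suc j) = (phi ^^ k) j + len k (T j)"
proof (induction k arbitrary: j)
  case 0
  then show ?case by simp
next
  case (Suc k)
  have *: "(phi ^^ Suc k) i = (phi ^^ k) (phi i)" for i by (simp add: funpow_swap1)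
  have a: "(phi ^^ k) (Suc (phi j)) = (phi ^^ k) (phi j) + trib k"
    using Suc.IH[of "phi j"] by (simp add: T_phi)
  have b: "(phi ^^ k) (Suc (Suc (phi j))) = (phi ^^ k) (phi j) + trib k + len k (cyc (T j))"
    using Suc.IH[of "Suc (phi j)"] a by (simp add: T_phi_1)
  show ?case unfolding * using a b
    by (cases "T j") (auto simp: phi_Suc trib_Suc len_Lb_Suc)
qed

lemma phi_pow_0 [simp]: "(phi ^^ k) 0 = 0"
  by (induction k) auto

lemma strict_mono_phi_pow: "strict_mono (phi ^^ k)"
  by (simp add: strict_mono_Suc_iff phi_pow_Suc len_pos)

lemmas phi_pow_le_iff = strict_mono_less_eq[OF strict_mono_phi_pow]

lemma phi_pow_1: "(phi ^^ k) (Suc 0) = trib k"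
  using phi_pow_Suc[of k 0] T_0 by simp

lemma T_1: "T (Suc 0) = Lb"
  using T_phi_1[of 0] T_0 by simp

lemma T_2: "T 2 = La"
  using T_not_La(3)[of "Suc 0"] T_1 by (simp add: numeral_2_eq_2)

lemma phi_pow_2: "(phi ^^ k) 2 = trib (Suc k)"
  using phi_pow_Suc[of k 1] phi_pow_1[of k] by (simp add: numeral_2_eq_2 T_1 trib_Suc)

lemma phi_2: "phi 2 = 4"
  using phi_pow_2[of 1] trib_init(3) by (simp add: numeral_2_eq_2)

lemma phi_pow_4: "(phi ^^ k) 4 = trib (Suc (Suc k))"
  using phi_pow_2[of "Suc k"] by (simp add: funpow_swap1 phi_2)

section \<open>Prefixes shared by all iterated images\<close>

text \<open>The prefix of length \<open>h k\<close> of the Tribonacci word is the longest word that starts at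
  position \<open>(phi ^^ k) j\<close> for every \<open>j\<close>.\<close>

fun h :: "nat \<Rightarrow> nat" where
  "h 0 = 0"
| "h (Suc k) = Suc (phi (h k))"

definition prefix_at :: "nat \<Rightarrow> nat \<Rightarrow> bool" where
  "prefix_at s n \<longleftrightarrow> (\<forall>x<n. T (s + x) = T x)"

lemma phi_add_prefix:
  assumes "prefix_at s n" "x \<le> n"
  shows "phi (s + x) = phi s + phi x"
  using assms(2)
proof (induction x)
  case (Suc x)
  then have "T (s + x) = T x" using assms(1) by (simp add: prefix_at_def)
  then show ?case using Suc by (simp add: phi_Suc)
qed simp

text \<open>Matching letters give matching blocks, which covers \<open>phi n\<close> positions; the
  next block begins with \<open>a\<close> whatever its letter, which gives one position
  more.\<close>

lemma prefix_at_phi: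
  assumes "prefix_at s n"
  shows "prefix_at (phi s) (Suc (phi n))"
  unfolding prefix_at_def
proof (intro allI impI)
  fix y assume y: "y < Suc (phi n)"
  show "T (phi s + y) = T y"
  proof (cases y rule: phi_cases)
    case (start j)
    then have "j \<le> n" using y phi_le_iff[of j n] by simp
    then have "phi s + y = phi (s + j)" using phi_add_prefix[OF assms] start by simp
    then show ?thesis using T_phi start by simp
  next
    case (inner j)
    then have j: "j < n" using y phi_less_iff[of j n] by simp
    then have "phi s + y = Suc (phi (s + j))" using phi_add_prefix[OF assms, of j] inner by simp
    moreover have "T (s + j) = T j" using assms j by (simp add: prefix_at_def)
    ultimately show ?thesis using T_phi_1 inner by simp
  qed
qed

lemma prefix_at_phi_pow: "prefix_at ((phi ^^ k) j) (h k)"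
proof (induction k)
  case 0
  then show ?case by (simp add: prefix_at_def)
next
  case (Suc k)
  then show ?case using prefix_at_phi by simp
qed

text \<open>Identifies \<open>h k\<close> with \<open>t_0 + ... + t_(k-1)\<close>.
  \<open>phi\<close> is additive on \<open>trib k + h k\<close> because the prefix of length
  \<open>h k\<close> occurs again at \<open>trib k = (phi ^^ k) 1\<close>.\<close>

lemma h_Suc: "h (Suc k) = h k + trib k"
proof (induction k)
  case 0
  then show ?case using trib_0_1_2 by simp
next
  case (Suc k)
  have "prefix_at (trib k) (h k)" using prefix_at_phi_pow[of k "Suc 0"] by (simp add: phi_pow_1)
  then have "phi (trib k + h k) = phi (trib k) + phi (h k)" using phi_add_prefix by blast
  moreover have "phi (trib k) = trib (Suc k)"
    using phi_pow_1[of k] phi_pow_1[of "Suc k"] by simp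
  moreover have "phi (h (Suc k)) = phi (trib k + h k)" using Suc.IH by (simp add: add.commute)
  ultimately show ?case by simp
qed

lemma two_h: "2 * h k + trib k + 3 = trib (Suc (Suc k))"
proof (induction k)
  case 0
  then show ?case by (simp add: trib_0_1_2)
next
  case (Suc k)
  then show ?case by (simp add: h_Suc trib_Suc3 del: h.simps(2))
qed

declare h.simps(2) [simp del]

lemma trib_le_h: "trib k \<le> Suc (h k)"
proof -
  have "trib k \<le> Suc (h k) \<and> trib (Suc k) \<le> Suc (h (Suc k)) \<and>
      trib (Suc (Suc k)) \<le> Suc (h (Suc (Suc k)))"
    by (induction k) (simp_all add: h_Suc trib_0_1_2 trib_Suc3)
  then show ?thesis by blast
qed

lemma h_less_trib: "h k < trib (Suc k)"
  using two_h[of k] trib_less_Suc[of k] trib_Suc3[of "k - 1"] trib_le_iff[of "k-1" k]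
  by (cases k) (auto simp: trib_0_1_2)

lemma h_less_two_trib: "h k < 2 * trib k"
proof (cases "k \<le> 1")
  case True
  then show ?thesis by (cases k) (auto simp: trib_0_1_2 h_Suc)
next
  case False
  then obtain l where l: "k = Suc (Suc l)" by (metis One_nat_def not0_implies_Suc not_less_eq_eq le0)
  have "trib (Suc l) + trib l \<le> trib k"
    using trib_Suc[of "Suc l"] len_Lb_Suc[of l] l by simp
  then show ?thesis
    using two_h[of k] trib_less_Suc[of l] trib_less_Suc[of "Suc l"] trib_Suc3[of l]
      trib_Suc3[of "Suc l"] l by simp
qed

lemma h_le_trib_add_trib: "h (Suc k) < trib (Suc k) + trib k"
  using h_Suc[of k] h_less_trib[of k] by simp

section \<open>Repetitions in the Tribonacci word\<close>

text \<open>\<open>matches s p n\<close> says that the factor of length \<open>p + n\<close> at position \<open>s\<close> has period \<open>p\<close>.\<close>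

definition matches :: "nat \<Rightarrow> nat \<Rightarrow> nat \<Rightarrow> bool" where
  "matches s p n \<longleftrightarrow> (\<forall>x<n. T (s + x) = T (s + p + x))"

definition square :: "nat \<Rightarrow> nat \<Rightarrow> bool" where
  "square i p \<longleftrightarrow> p > 0 \<and> matches i p p"

lemma matches_mono: "matches s p n \<Longrightarrow> r + k \<le> n \<Longrightarrow> matches (s + r) p k"
proof -
  assume m: "matches s p n" and r: "r + k \<le> n"
  have "T (s + r + x) = T (s + r + p + x)" if "x < k" for x
  proof -
    have "T (s + (r + x)) = T (s + p + (r + x))" using m r that by (simp add: matches_def)
    then show ?thesis by (simp add: ac_simps)
  qed
  then show ?thesis by (simp add: matches_def)
qed

lemma phi_add_ge: "phi s + y \<le> phi (s + y)"
proof (induction y)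
  case (Suc y)
  then show ?case using phi_less_Suc[of "s + y"] by simp
qed simp

text \<open>The same prefix of length \<open>h k\<close> starts at the blocks of \<open>j\<close>
  and of \<open>Suc j\<close>, which are \<open>len k (T j)\<close> apart.\<close>

lemma matches_phi_pow: "matches ((phi ^^ k) j) (len k (T j)) (h k)"
  using prefix_at_phi_pow[of k j] prefix_at_phi_pow[of k "Suc j"]
  unfolding matches_def prefix_at_def phi_pow_Suc by simp

text \<open>Desubstitution, by induction on the excess \<open>n\<close>: the run starts at a block
  boundary, and the letters behind its blocks form a left maximal run of smaller excess. The
  condition \<open>p \<le> Suc n\<close> is inherited by the preimage and forces
  \<open>p = 1\<close> once \<open>n = 0\<close>.\<close>

lemma left_maximal_run:
  assumes "matches s p n" "s = 0 \<or> T (s - 1) \<noteq> T (s - 1 + p)" "p > 0" "p \<le> Suc n"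
  shows "\<exists>k j. s = (phi ^^ k) j \<and> s + p = (phi ^^ k) (Suc j) \<and> n \<le> h k"
  using assms
proof (induction n arbitrary: s p rule: less_induct)
  case (less n)
  show ?case
  proof (cases "n = 0")
    case True
    then have "p = 1" using less.prems by simp
    then have "s = (phi ^^ 0) s \<and> s + p = (phi ^^ 0) (Suc s) \<and> n \<le> h 0" using True by simp
    then show ?thesis by blast
  next
    case False
    have first: "T s = T (s + p)"
      using less.prems(1) False unfolding matches_def by (auto dest: spec[of _ 0])
    \<comment> \<open>Any other letter is preceded by \<open>a\<close>, so the run could be extended
      to the left.\<close>
    have "T s = La"
    proof (rule ccontr)
      assume "T s \<noteq> La"
      then have "s > 0" "T (s - 1) = La" "T (s + p - 1) = La"
        using T_not_La[of s] T_not_La[of "s + p"] first by auto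
      moreover have "s + p - 1 = s - 1 + p" using \<open>s > 0\<close> by simp
      ultimately show False using less.prems(2) by auto
    qed
    then obtain s' q where s': "s = phi s'" and q: "s + p = phi q"
      using first T_eq_La_iff by metis
    have "phi s' < phi q" using s' q less.prems(3) by linarith
    then have "s' < q" by (simp add: phi_less_iff)
    define p' where "p' = q - s'"
    have p': "q = s' + p'" "p' > 0" using \<open>s' < q\<close> by (auto simp: p'_def)
    \<comment> \<open>\<open>n'\<close> is the least number of letters whose blocks, together with
      the \<open>a\<close> that follows them, cover the \<open>n\<close> matching positions. By
      minimality, the position that reveals each of these letters through \<open>cyc\<close> lies
      within the matching range.\<close>
    define n' where "n' = (LEAST y. Suc (phi (s' + y)) \<ge> s + n)"
    have ex: "Suc (phi (s' + n)) \<ge> s + n"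
      using phi_add_ge[of s' n] s' by simp
    have upper: "s + n \<le> Suc (phi (s' + n'))"
      unfolding n'_def by (rule LeastI[where P="\<lambda>y. Suc (phi (s' + y)) \<ge> s + n", OF ex])
    have lower: "Suc (phi (s' + y)) < s + n" if "y < n'" for y
      using not_less_Least[of y "\<lambda>y. Suc (phi (s' + y)) \<ge> s + n"] that unfolding n'_def by simp
    \<comment> \<open>Both claims need each other: equal letters keep the block starts
      \<open>p\<close> apart, and block starts \<open>p\<close> apart let the next letters be
      compared.\<close>
    have "phi (q + y) = phi (s' + y) + p \<and> (\<forall>x<y. T (s' + x) = T (q + x))" if "y \<le> n'" for y
      using that
    proof (induction y)
      case 0
      then show ?case using s' q by simp
    next
      case (Suc y)
      then have IH: "phi (q + y) = phi (s' + y) + p" "\<forall>x<y. T (s' + x) = T (q + x)" by auto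
      have "phi (s' + y) \<ge> phi s'" by (simp add: phi_le_iff)
      then obtain x where x: "Suc (phi (s' + y)) = s + x"
        using s' by (metis add_Suc_right le_iff_add)
      then have "x < n" using lower[of y] Suc.prems by simp
      then have "T (s + x) = T (s + p + x)" using less.prems(1) by (simp add: matches_def)
      moreover have "s + p + x = Suc (phi (q + y))" using x IH by simp
      ultimately have "cyc (T (s' + y)) = cyc (T (q + y))"
        using T_phi_1[of "s' + y"] T_phi_1[of "q + y"] x by simp
      then have "T (s' + y) = T (q + y)" using inj_cyc by (simp add: inj_def)
      then show ?case using IH by (auto simp: phi_Suc less_Suc_eq)
    qed
    from this[of n'] have match': "matches s' p' n'" by (simp add: matches_def p')
    have left': "s' = 0 \<or> T (s' - 1) \<noteq> T (s' - 1 + p')"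
    proof (rule ccontr)
      assume "\<not> ?thesis"
      then obtain r where r: "s' = Suc r" "T r = T (r + p')" by (cases s') auto
      then have "T (phi (Suc r) - 1) = T (phi (Suc (r + p')) - 1)" by (simp only: T_phi_last)
      moreover have "phi (Suc r) = s" "phi (Suc (r + p')) = s + p" using s' q p' r by auto
      moreover have "s > 0" using phi_less_Suc[of r] \<open>phi (Suc r) = s\<close> by linarith
      ultimately show False using less.prems(2) by (simp add: less_imp_Suc_add)
    qed
    \<comment> \<open>This is where the absence of \<open>cc\<close> enters: two further letters
      would push the second period at least 3 positions to the right, but
      \<open>p \<le> Suc n\<close> leaves room for only 2.\<close>
    have "p' \<le> Suc n'"
    proof (rule ccontr)
      assume "\<not> p' \<le> Suc n'"
      then have "phi (s' + n' + 2) \<le> phi q" using p' by (simp add: phi_le_iff)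
      then show False using phi_add_2[of "s' + n'"] upper less.prems(4) q by linarith
    qed
    have "n' < n"
    proof (cases n')
      case (Suc y)
      then show ?thesis using lower[of y] phi_add_ge[of s' y] s' by simp
    qed (use False in simp)
    from less.IH[OF this match' left' \<open>p' > 0\<close> \<open>p' \<le> Suc n'\<close>]
    obtain k j where kj: "s' = (phi ^^ k) j" "s' + p' = (phi ^^ k) (Suc j)" "n' \<le> h k" by blast
    \<comment> \<open>The bound \<open>n' \<le> h k\<close> lifts because \<open>phi\<close> is
      additive along the prefix at \<open>s'\<close>; the covering \<open>a\<close> accounts for the
      \<open>Suc\<close> in \<open>h (Suc k)\<close>.\<close>
    have "phi (s' + n') \<le> phi (s' + h k)" using kj by (simp add: phi_le_iff)
    also have "\<dots> = phi s' + phi (h k)"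
      using phi_add_prefix[OF prefix_at_phi_pow, of "h k" k j] kj by simp
    finally have "n \<le> h (Suc k)" using upper s' by (simp add: h.simps(2))
    moreover have "s = (phi ^^ Suc k) j" "s + p = (phi ^^ Suc k) (Suc j)"
      using s' q p' kj by auto
    ultimately show ?thesis by blast
  qed
qed

text \<open>Extending the run to the left raises \<open>n\<close> as \<open>s\<close> decreases,
  until it is left maximal; \<open>r\<close> records the number of steps.\<close>

lemma run_seed:
  assumes "matches s p n" "p > 0" "p \<le> n"
  obtains k j r where "s = (phi ^^ k) j + r" "p = len k (T j)" "r + n \<le> h k"
proof -
  have "\<exists>k j r. s = (phi ^^ k) j + r \<and> p = len k (T j) \<and> r + n \<le> h k"
    using assms
  proof (induction s arbitrary: n)
    case 0
    then obtain k j where "0 = (phi ^^ k) j" "0 + p = (phi ^^ k) (Suc j)" "n \<le> h k"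
      using left_maximal_run[of 0 p n] by auto
    then have "0 = (phi ^^ k) j + 0 \<and> p = len k (T j) \<and> 0 + n \<le> h k"
      by (simp add: phi_pow_Suc)
    then show ?case by blast
  next
    case (Suc s)
    show ?case
    proof (cases "T s = T (s + p)")
      case True
      then have "matches s p (Suc n)"
        using Suc.prems(1) unfolding matches_def by (auto simp: less_Suc_eq_0_disj)
      then obtain k j r where "s = (phi ^^ k) j + r \<and> p = len k (T j) \<and> r + Suc n \<le> h k"
        using Suc.IH[of "Suc n"] Suc.prems by auto
      then have "Suc s = (phi ^^ k) j + Suc r \<and> p = len k (T j) \<and> Suc r + n \<le> h k" by simp
      then show ?thesis by blast
    next
      case False
      then obtain k j where "Suc s = (phi ^^ k) j" "Suc s + p = (phi ^^ k) (Suc j)" "n \<le> h k"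
        using left_maximal_run[OF Suc.prems(1)] Suc.prems by auto
      then have "Suc s = (phi ^^ k) j + 0 \<and> p = len k (T j) \<and> 0 + n \<le> h k"
        by (simp add: phi_pow_Suc)
      then show ?thesis by blast
    qed
  qed
  then show ?thesis using that by blast
qed

lemma h_less_3_len: "h k < 3 * len k x"
proof (cases x)
  case La
  then show ?thesis using h_less_two_trib[of k] by simp
next
  case Lb
  show ?thesis
  proof (cases k)
    case (Suc l)
    then show ?thesis using Lb h_less_two_trib[of "l - 1"]
      by (cases l) (auto simp: h_Suc trib_0_1_2)
  qed (simp add: Lb)
next
  case Lc
  then show ?thesis using h_less_two_trib[of "k - 1"] by (cases k) (auto simp: h_Suc)
qed

text \<open>A fourth power exceeds its period by three periods, whereas the excess of a run is at
  most \<open>h k\<close>.\<close>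

lemma no_fourth_power:
  assumes "p > 0"
  shows "\<not> matches s p (3 * p)"
proof
  assume "matches s p (3 * p)"
  then obtain k j r where "s = (phi ^^ k) j + r" "p = len k (T j)" "r + 3 * p \<le> h k"
    using run_seed[of s p "3 * p"] assms by auto
  then show False using h_less_3_len[of k "T j"] by simp
qed

section \<open>A bijective parametrisation of the squares\<close>

text \<open>\<open>offs k x\<close> is the set of offsets \<open>r\<close> such that a letter \<open>x\<close> at position \<open>j\<close> accounts for the
  square of period \<open>len k x\<close> at position \<open>(phi ^^ k) j + r\<close>. Since \<open>c\<close> is mapped to an \<open>a\<close> followed
  by another \<open>a\<close>, the run generated by \<open>c\<close> at level \<open>k + 1\<close> contains those generated by these two
  letters \<open>a\<close> at level \<open>k\<close>; the squares of the latter two are removed from it.\<close>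

fun offs :: "nat \<Rightarrow> letter \<Rightarrow> nat set" where
  "offs k La = {..<h k + 1 - trib k}"
| "offs k Lb = {..<h k + 1 - len k Lb}"
| "offs 0 Lc = {}"
| "offs (Suc k) Lc = {h k + 1 - trib k..<trib k}"

lemma offs_square:
  assumes "r \<in> offs k x"
  shows "r + len k x \<le> h k"
proof (cases x)
  case Lc
  then show ?thesis using assms trib_le_h[of "k - 1"] by (cases k) (auto simp: h_Suc)
qed (use assms in auto)

text \<open>The square thus starts inside the block of its letter, so that
  \<open>block_unique\<close> can recover the letter.\<close>

lemma offs_less_len:
  assumes "r \<in> offs k x"
  shows "r < len k x"
proof (cases x)
  case La
  then show ?thesis using assms h_less_two_trib[of k] by auto
next
  case Lb
  show ?thesis
  proof (cases k)
    case (Suc l)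
    then show ?thesis using Lb assms h_less_trib[of "l - 1"]
      by (cases l) (auto simp: h_Suc trib_0_1_2)
  qed (use Lb assms in auto)
next
  case Lc
  then show ?thesis using assms by (cases k) auto
qed

definition cells :: "(nat \<times> nat \<times> nat) set" where
  "cells = {(k, j, r). r \<in> offs k (T j)}"

definition square_of :: "nat \<times> nat \<times> nat \<Rightarrow> nat \<times> nat" where
  "square_of = (\<lambda>(k, j, r). ((phi ^^ k) j + r, len k (T j)))"

lemma square_of_cells:
  assumes "z \<in> cells" "square_of z = (i, p)"
  shows "square i p"
proof -
  obtain k j r where "z = (k, j, r)" by (cases z)
  then have z: "r \<in> offs k (T j)" "i = (phi ^^ k) j + r" "p = len k (T j)"
    using assms by (auto simp: cells_def square_of_def)
  then show ?thesis
    using matches_mono[OF matches_phi_pow, of r p k j] offs_square len_pos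
    by (simp add: square_def)
qed

lemma square_in_image:
  assumes "square i p"
  shows "(i, p) \<in> square_of ` cells"
proof -
  obtain k j r where *: "i = (phi ^^ k) j + r" "p = len k (T j)" "r + p \<le> h k"
    using assms run_seed[of i p p] unfolding square_def by auto
  have cell: ?thesis if "r' \<in> offs k' (T j')" "i = (phi ^^ k') j' + r'" "p = len k' (T j')"
    for k' j' r'
    by (rule image_eqI[of _ _ "(k', j', r')"]) (use that in \<open>auto simp: cells_def square_of_def\<close>)
  show ?thesis
  proof (cases "T j")
    case La
    show ?thesis by (rule cell[of r k j]) (use * La in auto)
  next
    case Lb
    show ?thesis by (rule cell[of r k j]) (use * Lb in auto)
  next
    case Lc
    then obtain l where k: "k = Suc l" using * by (cases k) auto
    have p: "p = trib l" using * k Lc by simp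
    have i: "i = (phi ^^ l) (phi j) + r" using * k by (simp add: funpow_swap1)
    have Suc: "phi (Suc j) = Suc (phi j)" using Lc by (simp add: phi_Suc)
    have r: "r \<le> h l" using * p k by (simp add: h_Suc)
    \<comment> \<open>The outer ranges go to the two letters \<open>a\<close> at
      \<open>phi j\<close> and \<open>phi (Suc j)\<close> one level below; only the middle range
      stays with \<open>c\<close>.\<close>
    consider "r < h l + 1 - trib l" | "h l + 1 - trib l \<le> r" "r < trib l" | "trib l \<le> r"
      by linarith
    then show ?thesis
    proof cases
      case 1
      show ?thesis by (rule cell[of r l "phi j"]) (use 1 p i T_phi in auto)
    next
      case 2
      show ?thesis by (rule cell[of r k j]) (use 2 * k Lc in auto)
    next
      case 3
      have "(phi ^^ l) (phi (Suc j)) = (phi ^^ l) (phi j) + trib l"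
        unfolding Suc by (simp add: phi_pow_Suc T_phi)
      then show ?thesis
        by (intro cell[of "r - trib l" l "phi (Suc j)"]) (use 3 r p i T_phi in auto)
    qed
  qed
qed

section \<open>Uniqueness of the parametrisation\<close>

lemma block_unique:
  assumes "(phi ^^ k) i + r = (phi ^^ k) j + r'" "r < len k (T i)" "r' < len k (T j)"
  shows "i = j"
proof (rule ccontr)
  have less: "(phi ^^ k) i + len k (T i) \<le> (phi ^^ k) j" if "i < j" for i j
    using that phi_pow_le_iff[of k "Suc i" j] by (simp add: phi_pow_Suc)
  assume "i \<noteq> j"
  then show False using less[of i j] less[of j i] assms by linarith
qed

lemma offs_Lb_nonempty:
  assumes "r \<in> offs k Lb"
  obtains l where "k = Suc (Suc l)"
proof (cases k)
  case (Suc l)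
  then show ?thesis using assms that by (cases l) (auto simp: h_Suc trib_0_1_2)
qed (use assms in auto)

lemma offs_Lc_nonempty:
  assumes "r \<in> offs k Lc"
  obtains l where "k = Suc l"
  using assms by (cases k) auto

text \<open>The sum lies strictly between two consecutive Tribonacci numbers. This separates the
  periods coming from \<open>b\<close> from those coming from \<open>a\<close> and
  \<open>c\<close>.\<close>

lemma trib_neq_add: "trib q \<noteq> trib (Suc l) + trib l"
proof (cases "q \<le> Suc l")
  case True
  then show ?thesis using trib_le_iff[of q "Suc l"] trib_pos[of l] by simp
next
  case False
  then have "trib (Suc (Suc l)) \<le> trib q" by (simp add: trib_le_iff)
  moreover have "trib (Suc l) + trib l < trib (Suc (Suc l))"
    using trib_Suc3[of "l - 1"] trib_pos[of "l - 1"] by (cases l) (auto simp: trib_0_1_2)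
  ultimately show ?thesis by simp
qed

text \<open>The period determines level and letter up to the coincidence
  \<open>len (Suc k) Lc = len k La\<close>. Nonempty offset sets exclude the lowest levels, where
  further lengths coincide.\<close>

lemma len_eq_imp:
  assumes "r \<in> offs k x" "r' \<in> offs k' x'" "len k x = len k' x'"
  shows "k = k' \<and> x = x' \<or> x = La \<and> x' = Lc \<and> k' = Suc k \<or> x = Lc \<and> x' = La \<and> k = Suc k'"
proof -
  have less: "trib (Suc l) + trib l < trib (Suc l') + trib l'" if "l < l'" for l l'
    using that by (intro add_strict_mono) (simp_all add: trib_less_iff)
  have b: "l = l'" if "trib (Suc l) + trib l = trib (Suc l') + trib l'" for l l'
    using that less[of l l'] less[of l' l] by (cases l l' rule: linorder_cases) simp_all
  have ab: False if r: "r \<in> offs k Lb" and eq: "len k Lb = trib q" for r k q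
  proof -
    obtain l where "k = Suc (Suc l)" using r by (rule offs_Lb_nonempty)
    then show False using eq trib_neq_add[of q l] by simp
  qed
  have bc: False if r: "r \<in> offs k Lb" and r': "r' \<in> offs k' Lc" and eq: "len k Lb = len k' Lc" for r r' k k'
  proof -
    obtain l where "k' = Suc l" using r' by (rule offs_Lc_nonempty)
    then show False using r eq ab by simp
  qed
  show ?thesis
  proof (cases x; cases x')
    assume x: "x = Lb" "x' = Lb"
    obtain l where l: "k = Suc (Suc l)"
      using assms(1)[unfolded x] by (rule offs_Lb_nonempty)
    obtain l' where l': "k' = Suc (Suc l')"
      using assms(2)[unfolded x] by (rule offs_Lb_nonempty)
    have "trib (Suc l) + trib l = trib (Suc l') + trib l'" using assms(3) x l l' by simp
    then have "l = l'" by (rule b)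
    then show ?thesis using x l l' by simp
  next
    assume x: "x = La" "x' = Lc"
    obtain l where "k' = Suc l" using assms(2)[unfolded x] by (rule offs_Lc_nonempty)
    then show ?thesis using x assms by (simp add: trib_eq_iff)
  next
    assume x: "x = Lc" "x' = La"
    obtain l where "k = Suc l" using assms(1)[unfolded x] by (rule offs_Lc_nonempty)
    then show ?thesis using x assms by (simp add: trib_eq_iff)
  next
    assume x: "x = Lc" "x' = Lc"
    obtain l where "k = Suc l" using assms(1)[unfolded x] by (rule offs_Lc_nonempty)
    moreover obtain l' where "k' = Suc l'" using assms(2)[unfolded x] by (rule offs_Lc_nonempty)
    ultimately show ?thesis using x assms(3) by (simp add: trib_eq_iff)
  next
    assume "x = La" "x' = La"
    then show ?thesis using assms(3) by (simp add: trib_eq_iff)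
  next
    assume "x = La" "x' = Lb"
    then have False by (intro ab[of r' k' k]) (use assms in simp_all)
    then show ?thesis ..
  next
    assume "x = Lb" "x' = La"
    then have False by (intro ab[of r k k']) (use assms in simp_all)
    then show ?thesis ..
  next
    assume "x = Lb" "x' = Lc"
    then have False by (intro bc[of r k r' k']) (use assms in simp_all)
    then show ?thesis ..
  next
    assume "x = Lc" "x' = Lb"
    then have False by (intro bc[of r' k' r k]) (use assms in simp_all)
    then show ?thesis ..
  qed
qed

lemma inj_square_of: "inj_on square_of cells"
proof (rule inj_onI)
  fix z z' assume z: "z \<in> cells" "z' \<in> cells" "square_of z = square_of z'"
  obtain k j r k' j' r' where zz: "z = (k, j, r)" "z' = (k', j', r')" by (cases z; cases z') blast
  then have r: "r \<in> offs k (T j)" and r': "r' \<in> offs k' (T j')"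
    and i: "(phi ^^ k) j + r = (phi ^^ k') j' + r'" and p: "len k (T j) = len k' (T j')"
    using z by (auto simp: cells_def square_of_def)
  \<comment> \<open>Both squares start in the block of the first \<open>a\<close> in the image of
    the \<open>c\<close>, where the offsets for \<open>a\<close> and for \<open>c\<close> are
    disjoint.\<close>
  have clash: False
    if "T j = La" "T j' = Lc" "r \<in> offs k (T j)" "r' \<in> offs (Suc k) (T j')"
      "(phi ^^ k) j + r = (phi ^^ Suc k) j' + r'" for k j r j' r'
  proof -
    have *: "(phi ^^ k) j + r = (phi ^^ k) (phi j') + r'" using that by (simp add: funpow_swap1)
    moreover have "r < len k (T j)" using that offs_less_len by blast
    moreover have "r' < len k (T (phi j'))" using that by (auto simp: T_phi)
    ultimately have "j = phi j'" by (rule block_unique)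
    then have "r = r'" using * by simp
    then show False using that by auto
  qed
  from len_eq_imp[OF r r' p] have "k = k'"
  proof (elim disjE conjE)
    assume "T j = La" "T j' = Lc" "k' = Suc k"
    then show ?thesis using clash r r' i by blast
  next
    assume "T j = Lc" "T j' = La" "k = Suc k'"
    then show ?thesis using clash[of j' j r' k' r] r r' i by auto
  qed
  moreover from this have "j = j'"
    using block_unique[of k j r j' r'] i offs_less_len[OF r] offs_less_len[OF r'] by simp
  ultimately show "z = z'" using zz i by simp
qed

section \<open>Squares as pairs of consecutive occurrences\<close>

lemma occurrences_eq: "occurrences w = {i. i \<ge> 1 \<and> (\<forall>x<length w. T (i - 1 + x) = w ! x)}"
  unfolding occurrences_def by (auto simp: list_eq_iff_nth_eq sdrop_snth)

lemma concat_replicate_nth: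
  "x < n * length z \<Longrightarrow> concat (replicate n z) ! x = z ! (x mod length z)"
proof (induction n arbitrary: x)
  case (Suc n)
  show ?case
  proof (cases "x < length z")
    case False
    then show ?thesis
      using Suc.IH[of "x - length z"] Suc.prems by (simp add: nth_append le_mod_geq)
  qed (simp add: nth_append)
qed simp

text \<open>An occurrence of \<open>w\<close> strictly inside the square \<open>w w\<close> means \<open>w = u v = v u\<close>, so \<open>w\<close> is a
  proper power and \<open>w w\<close> contains a fourth power.\<close>

lemma no_inner_occurrence:
  assumes sq: "square i p" and d: "0 < d" "d < p"
    and inner: "\<And>x. x < p \<Longrightarrow> T (i + d + x) = T (i + x)"
  shows False
proof -
  define w where "w = map (\<lambda>x. T (i + x)) [0..<p]"
  define u where "u = take d w"
  define v where "v = drop d w"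
  have per: "T (i + p + x) = T (i + x)" if "x < p" for x
    using sq that by (simp add: square_def matches_def)
  have uv: "w = u @ v" by (simp add: u_def v_def)
  have lens: "length w = p" "length u = d" "length v = p - d"
    using d by (auto simp: w_def u_def v_def)
  have "w = v @ u"
  proof (rule nth_equalityI)
    show "length w = length (v @ u)" using lens d by simp
    fix x assume "x < length w"
    then have x: "x < p" using lens by simp
    have "w ! x = T (i + (d + x))" using inner[OF x] x by (simp add: w_def add.assoc)
    also have "\<dots> = (v @ u) ! x"
    proof (cases "x < p - d")
      case True
      then have "d + x < p" by simp
      then show ?thesis using True by (simp add: nth_append lens) (simp add: v_def w_def)
    next
      case False
      then obtain y where y: "x = (p - d) + y" by (metis le_add_diff_inverse not_less)
      then have *: "i + (d + x) = i + p + y" "y < d" using d x by auto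
      have "T (i + (d + x)) = T (i + y)" using per[of y] * d by (simp add: add.assoc)
      also have "\<dots> = u ! y" using * d by (simp add: u_def w_def)
      also have "\<dots> = (v @ u) ! x" using y lens by (simp add: nth_append)
      finally show ?thesis .
    qed
    finally show "w ! x = (v @ u) ! x" .
  qed
  then have "u @ v = v @ u" using uv by simp
  from comm_append_are_replicate[OF this] obtain m n z
    where z: "concat (replicate m z) = u" "concat (replicate n z) = v" by blast
  have "u \<noteq> []" "v \<noteq> []" using lens d by auto
  then have pos: "m > 0" "n > 0" "length z > 0" using z by (auto intro: gr0I)
  define N where "N = m + n"
  define g where "g = length z"
  have w: "w = concat (replicate N z)" using uv z by (simp add: N_def replicate_add)
  then have p: "p = N * g" using lens by (simp add: g_def length_concat sum_list_replicate)
  have ww: "T (i + x) = z ! (x mod g)" if "x < 2 * p" for x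
  proof (cases "x < p")
    case True
    have "T (i + x) = w ! x" using True by (simp add: w_def)
    then show ?thesis using concat_replicate_nth[of x N z] w p True by (simp add: g_def)
  next
    case False
    then obtain y where y: "x = p + y" by (metis le_add_diff_inverse not_less)
    then have "y < p" using that by simp
    then have "T (i + x) = w ! y" using per[of y] y by (simp add: w_def add.assoc)
    moreover have "x mod g = y mod g" using y p by simp
    ultimately show ?thesis
      using concat_replicate_nth[of y N z] w p \<open>y < p\<close> by (simp add: g_def)
  qed
  have "4 * g \<le> 2 * p" using p pos by (simp add: N_def)
  then have "matches i g (3 * g)"
    unfolding matches_def using ww by (simp add: add.assoc)
  then show False using no_fourth_power pos by (simp add: g_def)
qed

text \<open>The pair of a word and an index is sent to the start of that occurrence and the length
  of the word. The map is onto because no occurrence of \<open>w\<close> lies strictly between the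
  two halves of a square \<open>w w\<close>.\<close>

lemma num_squares_eq: "num_squares n = card {(i, p). square i p \<and> i + 2 * p \<le> n}"
proof -
  define A where "A = {(w, p). w \<noteq> [] \<and> is_factor w \<and> p \<ge> 1 \<and> is_square_at w p \<and>
     occ w (p + 1) + length w - 1 \<le> n}"
  define B where "B = {(i, p). square i p \<and> i + 2 * p \<le> n}"
  \<comment> \<open>Occurrences are positions counted from 1, squares start at positions counted
    from 0.\<close>
  define f where "f = (\<lambda>(w, p). (occ w p - 1, length w))"
  have occ_in: "occ w p \<in> occurrences w" if "is_factor w" for w p
    using that by (simp add: occ_def enumerate_in_set infinite_occurrences)
  have occ_nth: "occ w p \<ge> 1" "\<And>x. x < length w \<Longrightarrow> T (occ w p - 1 + x) = w ! x"
    if "is_factor w" for w p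
    using occ_in[OF that, of p] by (auto simp: occurrences_eq)
  have "bij_betw f A B"
    unfolding bij_betw_def
  proof (intro conjI set_eqI iffI)
    show "inj_on f A"
    proof (rule inj_onI)
      fix a b assume ab: "a \<in> A" "b \<in> A" "f a = f b"
      obtain w p v q where ws: "a = (w, p)" "b = (v, q)" by (cases a; cases b) blast
      have fac: "is_factor w" "is_factor v" "p \<ge> 1" "q \<ge> 1" using ab ws by (auto simp: A_def)
      have eq: "occ w p - 1 = occ v q - 1" "length w = length v" using ab ws by (auto simp: f_def)
      have "w = v"
      proof (rule nth_equalityI)
        fix x assume "x < length w"
        then show "w ! x = v ! x"
          using occ_nth(2)[OF fac(1), of x p] occ_nth(2)[OF fac(2), of x q] eq by simp
      qed (rule eq)
      moreover have "occ w p = occ w q"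
        using \<open>w = v\<close> eq occ_nth(1)[OF fac(1), of p] occ_nth(1)[OF fac(2), of q] by simp
      then have "p - 1 = q - 1"
        unfolding occ_def using strict_mono_enumerate[OF infinite_occurrences[OF fac(1)]]
        by (simp add: strict_mono_eq)
      ultimately show "a = b" using ws fac by simp
    qed
  next
    fix b assume "b \<in> f ` A"
    then obtain w p where wp: "(w, p) \<in> A" "b = f (w, p)" by auto
    then have fac: "is_factor w" "w \<noteq> []" and next_occ: "occ w (p + 1) = occ w p + length w"
      and bound: "occ w (p + 1) + length w - 1 \<le> n"
      by (auto simp: A_def is_square_at_def)
    have ge: "occ w p \<ge> 1" using occ_nth(1)[OF fac(1)] .
    have "T (occ w p - 1 + x) = T (occ w p - 1 + length w + x)" if "x < length w" for x
    proof -
      have "T (occ w p - 1 + x) = T (occ w (p + 1) - 1 + x)"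
        using occ_nth(2)[OF fac(1) that, of p] occ_nth(2)[OF fac(1) that, of "p + 1"] by simp
      moreover have "occ w (p + 1) - 1 = occ w p - 1 + length w" using next_occ ge by simp
      ultimately show ?thesis by simp
    qed
    then have "square (occ w p - 1) (length w)" using fac by (simp add: square_def matches_def)
    then show "b \<in> B" using wp next_occ bound ge by (simp add: B_def f_def)
  next
    fix b assume "b \<in> B"
    then obtain i p where b: "b = (i, p)" "square i p" "i + 2 * p \<le> n" by (auto simp: B_def)
    define w where "w = map (\<lambda>x. T (i + x)) [0..<p]"
    have p: "p > 0" "length w = p" "w \<noteq> []" using b by (auto simp: square_def w_def)
    have occs: "Suc j \<in> occurrences w \<longleftrightarrow> (\<forall>x<p. T (j + x) = T (i + x))" for j
      by (auto simp: occurrences_eq w_def)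
    have i_occ: "Suc i \<in> occurrences w" using occs by simp
    then have fac: "is_factor w" by (auto simp: is_factor_def)
    obtain q where q: "enumerate (occurrences w) q = Suc i"
      using enumerate_Ex[OF infinite_occurrences[OF fac] i_occ] by blast
    have ip_occ: "Suc (i + p) \<in> occurrences w"
      unfolding occs using b(2) by (simp add: square_def matches_def)
    have "enumerate (occurrences w) (Suc q)
        = (LEAST s. s \<in> occurrences w \<and> enumerate (occurrences w) q < s)"
      by (rule enumerate_Suc''[OF infinite_occurrences[OF fac]])
    also have "\<dots> = Suc (i + p)"
    proof (rule Least_equality)
      show "Suc (i + p) \<in> occurrences w \<and> enumerate (occurrences w) q < Suc (i + p)"
        using ip_occ q p by simp
      fix s assume s: "s \<in> occurrences w \<and> enumerate (occurrences w) q < s"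
      show "Suc (i + p) \<le> s"
      proof (rule ccontr)
        assume "\<not> Suc (i + p) \<le> s"
        moreover have "Suc i < s" using s q by simp
        moreover define d where "d = s - Suc i"
        ultimately have d: "s = Suc (i + d)" "0 < d" "d < p" by auto
        have "Suc (i + d) \<in> occurrences w" using s d(1) by simp
        then show False using no_inner_occurrence[OF b(2) d(2,3)] occs by simp
      qed
    qed
    finally have "enumerate (occurrences w) (Suc q) = Suc (i + p)" .
    then have "(w, Suc q) \<in> A" "f (w, Suc q) = b"
      using q p fac b by (auto simp: A_def f_def is_square_at_def occ_def)
    then show "b \<in> f ` A" by blast
  qed
  then show ?thesis
    unfolding num_squares_def A_def[symmetric] B_def[symmetric] by (rule bij_betw_same_card)
qed

section \<open>Counting\<close>

lemma offs_end:
  assumes "r \<in> offs k x"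
  shows "h k < r + 2 * len k x"
proof (cases x)
  case La
  then show ?thesis using h_less_two_trib[of k] by simp
next
  case Lb
  obtain l where "k = Suc (Suc l)" using assms[unfolded Lb] by (rule offs_Lb_nonempty)
  then show ?thesis using Lb h_less_two_trib[of l] trib_less_Suc[of l] by (simp add: h_Suc)
next
  case Lc
  obtain l where "k = Suc l" using assms[unfolded Lc] by (rule offs_Lc_nonempty)
  then show ?thesis using Lc assms by (auto simp: h_Suc)
qed

lemma len_Lb_le: "len k Lb \<le> trib k"
proof (cases k)
  case (Suc l)
  show ?thesis
  proof (cases l)
    case (Suc i)
    then show ?thesis
      using \<open>k = Suc l\<close> trib_Suc[of l] len_Lb_Suc[of i] by simp
  qed (simp add: Suc trib_0_1_2)
qed (simp add: trib_0_1_2)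

lemma trib_le_two_len: "trib k \<le> 2 * len k x"
proof (cases x)
  case Lb
  then show ?thesis using len_Lb_le[of "k - 1"] by (cases k) (auto simp: trib_0_1_2 trib_Suc len_Lb_Suc)
next
  case Lc
  then show ?thesis using len_Lb_le[of "k - 1"] by (cases k) (auto simp: trib_0_1_2 trib_Suc)
qed simp

text \<open>The least length of a prefix that contains the square of the cell.\<close>

definition cell_end :: "nat \<times> nat \<times> nat \<Rightarrow> nat" where
  "cell_end = (\<lambda>(k, j, r). (phi ^^ k) j + r + 2 * len k (T j))"

lemma cell_end_le:
  assumes "r \<in> offs k (T j)"
  shows "cell_end (k, j, r) \<le> (phi ^^ k) (Suc j) + h k"
  using offs_square[OF assms] by (simp add: cell_end_def phi_pow_Suc)

text \<open>The squares of the letter at \<open>j\<close> end after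
  \<open>(phi ^^ k) j + h k\<close> and no later than \<open>(phi ^^ k) (Suc j) + h k\<close>. These
  intervals are consecutive, so a prefix of this form contains all squares of a letter or
  none.\<close>

lemma cell_end_le_iff:
  assumes "r \<in> offs k (T j)"
  shows "cell_end (k, j, r) \<le> (phi ^^ k) s + h k \<longleftrightarrow> j < s"
proof
  assume "j < s"
  then have "(phi ^^ k) (Suc j) \<le> (phi ^^ k) s" by (simp add: phi_pow_le_iff)
  then show "cell_end (k, j, r) \<le> (phi ^^ k) s + h k" using cell_end_le[OF assms] by simp
next
  assume "cell_end (k, j, r) \<le> (phi ^^ k) s + h k"
  then have "(phi ^^ k) j < (phi ^^ k) s" using offs_end[OF assms] by (simp add: cell_end_def)
  then show "j < s" by (simp add: strict_mono_less[OF strict_mono_phi_pow])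
qed

text \<open>Bounds the levels that can contribute to a prefix: a square of the first letter has
  period \<open>trib k\<close>, and any later one starts at \<open>trib k\<close> or beyond with a
  period of at least half of it.\<close>

lemma cell_end_ge: "2 * trib k \<le> cell_end (k, j, r)"
proof (cases j)
  case 0
  then show ?thesis by (simp add: cell_end_def T_0)
next
  case (Suc l)
  then have "trib k \<le> (phi ^^ k) j"
    using phi_pow_le_iff[of k "Suc 0" j] by (simp add: phi_pow_1)
  then show ?thesis using trib_le_two_len[of k "T j"] by (simp add: cell_end_def)
qed

lemma cell_end_ge_nonzero:
  assumes "j > 0"
  shows "trib k + 2 * len k Lb \<le> cell_end (k, j, r)"
proof (cases "j = 1")
  case True
  then show ?thesis by (simp add: cell_end_def T_1 phi_pow_1)
next
  case False
  then have "trib (Suc k) \<le> (phi ^^ k) j"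
    using assms phi_pow_le_iff[of k 2 j] by (simp add: phi_pow_2)
  then show ?thesis using trib_le_two_len[of k "T j"] len_Lb_le[of k]
    by (simp add: cell_end_def trib_Suc)
qed

lemma finite_offs: "finite (offs k x)"
  by (cases "(k, x)" rule: offs.cases) auto

lemma num_squares_sum:
  assumes "\<And>k j r. r \<in> offs k (T j) \<Longrightarrow> cell_end (k, j, r) \<le> n \<longleftrightarrow> k < N \<and> j < s k"
  shows "num_squares n = (\<Sum>k<N. \<Sum>j<s k. card (offs k (T j)))"
proof -
  define I where "I = (SIGMA k:{..<N}. SIGMA j:{..<s k}. offs k (T j))"
  have I: "I = {z \<in> cells. cell_end z \<le> n}"
    using assms by (auto simp: I_def cells_def)
  have "{(i, p). square i p \<and> i + 2 * p \<le> n} = square_of ` I"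
  proof (intro set_eqI iffI)
    fix b assume "b \<in> {(i, p). square i p \<and> i + 2 * p \<le> n}"
    then obtain i p where b: "b = (i, p)" "square i p" "i + 2 * p \<le> n" by auto
    then obtain z where z: "z \<in> cells" "square_of z = b" using square_in_image by (metis imageE)
    then have "cell_end z \<le> n" using b by (cases z) (auto simp: cell_end_def square_of_def)
    then show "b \<in> square_of ` I" using z I by blast
  next
    fix b assume "b \<in> square_of ` I"
    then obtain z where z: "z \<in> cells" "cell_end z \<le> n" "square_of z = b" using I by blast
    then show "b \<in> {(i, p). square i p \<and> i + 2 * p \<le> n}"
      using square_of_cells[OF z(1)] by (cases z) (auto simp: cell_end_def square_of_def)
  qed
  moreover have "inj_on square_of I" using inj_square_of I by (auto intro: inj_on_subset)
  ultimately have "num_squares n = card I" by (simp add: num_squares_eq card_image)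
  also have "\<dots> = (\<Sum>k<N. \<Sum>j<s k. card (offs k (T j)))"
    by (simp add: I_def finite_offs)
  finally show ?thesis .
qed

text \<open>The map taking \<open>s\<close> to \<open>(phi ^^ k) s + h k\<close> is the
  \<open>k\<close>-th iterate of the one taking \<open>s\<close> to
  \<open>Suc (phi s)\<close>.\<close>

lemma phi_pow_add_h: "(phi ^^ k) ((phi ^^ l) s + h l) + h k = (phi ^^ (k + l)) s + h (k + l)"
proof (induction k)
  case (Suc k)
  have *: "phi ((phi ^^ k) j + h k) = phi ((phi ^^ k) j) + phi (h k)" for j k
    using phi_add_prefix[OF prefix_at_phi_pow] by blast
  show ?case
    using arg_cong[OF Suc.IH, of "\<lambda>x. Suc (phi x)"] by (simp add: * h.simps(2))
qed simp

text \<open>Counts the squares of levels up to \<open>i\<close> in the prefix of length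
  \<open>(phi ^^ i) s + h i\<close>; the inner range is the prefix \<open>k\<close> iterations
  earlier.\<close>

definition squares_upto_level :: "nat \<Rightarrow> nat \<Rightarrow> nat" where
  "squares_upto_level i s =
    (\<Sum>k\<le>i. \<Sum>j<(phi ^^ (i - k)) s + h (i - k). card (offs k (T j)))"

lemma cell_end_le_level:
  assumes "r \<in> offs k (T j)" "k \<le> i"
  shows "cell_end (k, j, r) \<le> (phi ^^ i) s + h i \<longleftrightarrow> j < (phi ^^ (i - k)) s + h (i - k)"
  using cell_end_le_iff[OF assms(1), of "(phi ^^ (i - k)) s + h (i - k)"]
    phi_pow_add_h[of k "i - k" s] assms(2) by simp

lemma num_squares_level:
  assumes "(phi ^^ i) s + h i < 2 * trib (Suc i)"
  shows "num_squares ((phi ^^ i) s + h i) = squares_upto_level i s"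
  unfolding squares_upto_level_def lessThan_Suc_atMost[symmetric]
proof (rule num_squares_sum)
  fix k j r assume r: "r \<in> offs k (T j)"
  show "cell_end (k, j, r) \<le> (phi ^^ i) s + h i \<longleftrightarrow> k < Suc i \<and> j < (phi ^^ (i - k)) s + h (i - k)"
  proof (cases "k < Suc i")
    case False
    then have "trib (Suc i) \<le> trib k" by (simp add: trib_le_iff)
    then have "\<not> cell_end (k, j, r) \<le> (phi ^^ i) s + h i"
      using cell_end_ge[of k j r] assms by linarith
    then show ?thesis using False by blast
  qed (use cell_end_le_level[OF r] in auto)
qed

text \<open>Here the first letter of the word also contributes at level \<open>i + 1\<close>.\<close>

lemma num_squares_level_4:
  "num_squares (trib (Suc (Suc i)) + h i) = squares_upto_level i 4 + card (offs (Suc i) La)"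
proof -
  let ?n = "trib (Suc (Suc i)) + h i"
  define s where "s k = (if k \<le> i then (phi ^^ (i - k)) 4 + h (i - k) else 1)" for k
  have "num_squares ?n = (\<Sum>k<Suc (Suc i). \<Sum>j<s k. card (offs k (T j)))"
  proof (rule num_squares_sum)
    fix k j r assume r: "r \<in> offs k (T j)"
    consider "k \<le> i" | "k = Suc i" | "Suc (Suc i) \<le> k" by linarith
    then show "cell_end (k, j, r) \<le> ?n \<longleftrightarrow> k < Suc (Suc i) \<and> j < s k"
    proof cases
      case 1
      then show ?thesis using cell_end_le_level[OF r, of i 4] by (simp add: phi_pow_4 s_def)
    next
      case 2
      have "cell_end (k, j, r) \<le> ?n" if "j = 0"
      proof -
        have "(phi ^^ k) (Suc j) = trib (Suc i)" using phi_pow_1[of k] that 2 by (simp del: funpow.simps)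
        then show ?thesis
          using cell_end_le[OF r] 2 by (simp add: h_Suc trib_Suc len_Lb_Suc del: funpow.simps)
      qed
      moreover have "\<not> cell_end (k, j, r) \<le> ?n" if "j > 0"
      proof -
        have "h i < len (Suc i) Lb"
          using h_le_trib_add_trib[of "i - 1"] by (cases i) auto
        then show ?thesis using cell_end_ge_nonzero[OF that, of k r] 2
          by (simp add: trib_Suc[of "Suc i"])
      qed
      ultimately show ?thesis using 2 by (auto simp: s_def)
    next
      case 3
      then have "trib (Suc (Suc i)) \<le> trib k" by (simp add: trib_le_iff)
      moreover have "h i < trib (Suc (Suc i))"
        using h_less_trib[of i] trib_less_Suc[of "Suc i"] by simp
      ultimately have "\<not> cell_end (k, j, r) \<le> ?n" using cell_end_ge[of k j r] by linarith
      then show ?thesis using 3 by simp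
    qed
  qed
  also have "\<dots> = squares_upto_level i 4 + card (offs (Suc i) La)"
    by (simp add: squares_upto_level_def s_def lessThan_Suc_atMost T_0 del: offs.simps)
  finally show ?thesis .
qed

section \<open>Closed forms\<close>

definition count :: "letter \<Rightarrow> nat \<Rightarrow> nat" where
  "count x s = (\<Sum>j<s. of_bool (T j = x))"

lemma count_0 [simp]: "count x 0 = 0"
  by (simp add: count_def)

lemma count_Suc: "count x (Suc s) = count x s + of_bool (T s = x)"
  by (simp add: count_def)

text \<open>Every block contains exactly one \<open>a\<close>; each \<open>b\<close> stems from an
  \<open>a\<close> and each \<open>c\<close> from a \<open>b\<close>.\<close>

lemma count_phi: "count La (phi s) = s \<and> count Lb (phi s) = count La s \<and> count Lc (phi s) = count Lb s"
proof (induction s)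
  case (Suc s)
  then show ?case by (cases "T s") (auto simp: phi_Suc count_Suc T_phi T_phi_1)
qed simp

lemma count_sum: "count La s + count Lb s + count Lc s = s"
proof (induction s)
  case (Suc s)
  then show ?case by (cases "T s") (auto simp: count_Suc)
qed simp

lemma count_Suc_phi:
  "count La (Suc (phi s)) = Suc (count La s + count Lb s + count Lc s)"
  "count Lb (Suc (phi s)) = count La s"
  "count Lc (Suc (phi s)) = count Lb s"
  by (simp_all add: count_Suc count_phi T_phi count_sum)

lemma sum_letters:
  "(\<Sum>j<s. f (T j)) = count La s * f La + count Lb s * f Lb + count Lc s * (f Lc :: nat)"
proof (induction s)
  case (Suc s)
  then show ?case by (cases "T s") (auto simp: count_Suc)
qed simp

text \<open>At the top level only the first \<open>s\<close> letters count; the lower levels see the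
  iteration started one step later, at \<open>Suc (phi s)\<close>.\<close>

lemma squares_upto_level_Suc:
  "squares_upto_level (Suc i) s =
    squares_upto_level i (Suc (phi s)) + (\<Sum>j<s. card (offs (Suc i) (T j)))"
proof -
  have "(phi ^^ (Suc i - k)) s + h (Suc i - k) = (phi ^^ (i - k)) (Suc (phi s)) + h (i - k)"
    if "k \<le> i" for k
    using that by (simp add: Suc_diff_le phi_pow_Suc T_phi h_Suc funpow_swap1)
  then show ?thesis by (simp add: squares_upto_level_def)
qed

text \<open>The subtractions in \<open>offs\<close> are exact here, so the cardinalities are affine
  in Tribonacci numbers; the factor 2 clears the denominator in the closed form of
  \<open>h\<close>.\<close>

lemma two_card_offs:
  "2 * real (card (offs k La)) = real (trib (k + 2)) - 3 * real (trib k) - 1"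
  "2 * real (card (offs k Lb)) = real (trib (k + 2)) + real (trib k) - 2 * real (trib (k + 1)) - 1"
  "2 * real (card (offs (Suc k) Lc)) = 5 * real (trib k) - real (trib (k + 2)) + 1"
proof -
  have h: "2 * real (h k) = real (trib (k + 2)) - real (trib k) - 3"
    using arg_cong[OF two_h[of k], of real] by simp
  have b: "real (len k Lb) = real (trib (k + 1)) - real (trib k)"
    using trib_Suc[of k] by simp
  have "real (card (offs k La)) = real (h k) + 1 - real (trib k)"
    using trib_le_h[of k] by simp
  then show "2 * real (card (offs k La)) = real (trib (k + 2)) - 3 * real (trib k) - 1"
    using h by simp
  have "real (card (offs k Lb)) = real (h k) + 1 - real (len k Lb)"
    using trib_le_h[of k] len_Lb_le[of k] by simp
  then show "2 * real (card (offs k Lb)) =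
      real (trib (k + 2)) + real (trib k) - 2 * real (trib (k + 1)) - 1"
    using h b by simp
  have "real (card (offs (Suc k) Lc)) = 2 * real (trib k) - real (h k) - 1"
    using trib_le_h[of k] h_less_two_trib[of k] by simp
  then show "2 * real (card (offs (Suc k) Lc)) = 5 * real (trib k) - real (trib (k + 2)) + 1"
    using h by simp
qed

lemma card_offs_0: "card (offs 0 x) = 0"
  by (cases x) (auto simp: trib_0_1_2)

text \<open>The summands of the total are convolutions of Tribonacci-like sequences; the coefficients
  below solve the linear recurrence that results from \<open>squares_upto_level_Suc\<close>.\<close>

lemma squares_upto_level_closed:
  fixes i s :: nat and x y z :: real
  defines "x \<equiv> real (trib i)" and "y \<equiv> real (trib (i + 1))" and "z \<equiv> real (trib (i + 2))"
  shows "44 * real (squares_upto_level i s) =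
      real (count La s) * (i * (20 * x - 18 * y + 8 * z) - 151 * x + 44 * y + 13 * z + 11)
    + real (count Lb s) * (i * (46 * y - 12 * x - 18 * z) + 150 * x - 110 * y + 12 * z + 22)
    + real (count Lc s) * (i * (20 * z - 38 * x - 12 * y) + 123 * x + 44 * y - 61 * z + 33)
    + (i * (8 * y - 15 * x + 5 * z) + 105 * x - 51 * z + 99 + 11 * real i)"
  unfolding x_def y_def z_def
proof (induction i arbitrary: s)
  case 0
  then show ?case
    by (simp add: squares_upto_level_def card_offs_0 trib_0_1_2)
next
  case (Suc i)
  define x where x: "x = real (trib i)"
  define y where y: "y = real (trib (i + 1))"
  define z where z: "z = real (trib (i + 2))"
  note xyz = x y z
  define A where A: "A = real (count La s)"
  define B where B: "B = real (count Lb s)"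
  define C where C: "C = real (count Lc s)"
  note ABC = A B C
  have t: "real (trib (Suc i)) = y" "real (trib (Suc i + 1)) = z" "real (trib (Suc i + 2)) = z + y + x"
    using trib_Suc3[of i] by (simp_all add: xyz)
  have "(\<Sum>j<s. card (offs (Suc i) (T j))) =
    count La s * card (offs (Suc i) La) + count Lb s * card (offs (Suc i) Lb)
      + count Lc s * card (offs (Suc i) Lc)"
    by (rule sum_letters)
  then have "2 * real (\<Sum>j<s. card (offs (Suc i) (T j))) =
      A * (2 * real (card (offs (Suc i) La))) + B * (2 * real (card (offs (Suc i) Lb)))
      + C * (2 * real (card (offs (Suc i) Lc)))"
    by (simp add: ABC algebra_simps del: offs.simps)
  also have "\<dots> = A * (z + y + x - 3 * y - 1) + B * (z + y + x + y - 2 * z - 1) + C * (5 * x - z + 1)"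
    by (simp only: two_card_offs t) (simp only: xyz)
  finally have sum: "2 * real (\<Sum>j<s. card (offs (Suc i) (T j))) = \<dots>" .
  \<comment> \<open>The letter counts of \<open>Suc (phi s)\<close> are affine in those of
    \<open>s\<close>, so the hypothesis becomes an expression in \<open>A\<close>, \<open>B\<close>,
    \<open>C\<close>.\<close>
  have IH: "44 * real (squares_upto_level i (Suc (phi s))) =
      (A + B + C + 1) * (i * (20 * x - 18 * y + 8 * z) - 151 * x + 44 * y + 13 * z + 11)
    + A * (i * (46 * y - 12 * x - 18 * z) + 150 * x - 110 * y + 12 * z + 22)
    + B * (i * (20 * z - 38 * x - 12 * y) + 123 * x + 44 * y - 61 * z + 33)
    + (i * (8 * y - 15 * x + 5 * z) + 105 * x - 51 * z + 99 + 11 * real i)"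
    using Suc.IH[of "Suc (phi s)"] unfolding count_Suc_phi xyz[symmetric]
    by (simp add: ABC algebra_simps)
  have "44 * real (squares_upto_level (Suc i) s) =
      44 * real (squares_upto_level i (Suc (phi s)))
      + 22 * (2 * real (\<Sum>j<s. card (offs (Suc i) (T j))))"
    by (simp add: squares_upto_level_Suc)
  also have "\<dots> =
      A * (real (Suc i) * (20 * y - 18 * z + 8 * (z + y + x)) - 151 * y + 44 * z + 13 * (z + y + x) + 11)
    + B * (real (Suc i) * (46 * z - 12 * y - 18 * (z + y + x)) + 150 * y - 110 * z + 12 * (z + y + x) + 22)
    + C * (real (Suc i) * (20 * (z + y + x) - 38 * y - 12 * z) + 123 * y + 44 * z - 61 * (z + y + x) + 33)
    + (real (Suc i) * (8 * z - 15 * y + 5 * (z + y + x)) + 105 * y - 51 * (z + y + x) + 99 + 11 * real (Suc i))"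
    unfolding IH sum by (simp add: algebra_simps)
  finally show ?case unfolding t ABC[symmetric] .
qed

section \<open>The maxima of the three sets and the final formulas\<close>

lemma Max_half:
  assumes "l \<le> u" "u = 2 * int n"
  shows "nat (Max {l div 2..u div 2}) = n"
proof -
  have "Max {l div 2..u div 2} = u div 2"
    using assms zdiv_mono1[of l u 2] by (intro Max_eqI) auto
  then show ?thesis using assms by simp
qed

text \<open>By \<open>phi_pow_2\<close> and \<open>phi_pow_4\<close> these are the lengths
  \<open>(phi ^^ k) s + h k\<close> for \<open>k = m\<close>, \<open>m - 2\<close>,
  \<open>m - 3\<close> and \<open>s = 0\<close>, \<open>2\<close>, \<open>4\<close>.\<close>

lemma Max_Gamma:
  assumes "m \<ge> 4"
  shows "nat (Max (Gamma1 m)) = h m"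
    and "nat (Max (Gamma2 m)) = trib (m - 1) + h (m - 2)"
    and "nat (Max (Gamma3 m)) = trib (m - 1) + h (m - 3)"
proof -
  define n where "n = m - 4"
  have m: "m = Suc (Suc (Suc (Suc n)))" using assms by (simp add: n_def)
  have idx: "m - 1 = Suc (Suc (Suc n))" "m - 2 = Suc (Suc n)" "m - 3 = Suc n" by (simp_all add: m)
  note rec = trib_Suc3[of n] trib_Suc3[of "Suc n"] trib_Suc3[of "Suc (Suc n)"]
    trib_Suc3[of "Suc (Suc (Suc n))"] trib_pos[of n] trib_pos[of "Suc n"] trib_pos[of "Suc (Suc n)"]
  have two_h_int: "2 * int (h k) = int (trib (Suc (Suc k))) - int (trib k) - 3" for k
    using two_h[of k] by linarith
  show "nat (Max (Gamma1 m)) = h m"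
    unfolding Gamma1_def Let_def idx unfolding m
    by (rule Max_half) (use rec in \<open>simp_all add: two_h_int\<close>)
  show "nat (Max (Gamma2 m)) = trib (m - 1) + h (m - 2)"
    unfolding Gamma2_def Let_def idx unfolding m
    by (rule Max_half) (use rec in \<open>simp_all add: two_h_int\<close>)
  show "nat (Max (Gamma3 m)) = trib (m - 1) + h (m - 3)"
    unfolding Gamma3_def Let_def idx unfolding m
    by (rule Max_half) (use rec in \<open>simp_all add: two_h_int\<close>)
qed

theorem mainTheorem7:
  fixes m :: nat
  assumes "m \<ge> 5"
  shows "let t = (\<lambda>k. real (trib k)) in
      real (num_squares (nat (Max (Gamma3 m)))) =
        real m / 44 * (- 25 * t m + 48 * t (m - 1) + 31 * t (m - 2))
        + 1 / 44 * (173 * t m - 294 * t (m - 1) - 213 * t (m - 2)) + (real m + 11) / 4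
    \<and> real (num_squares (nat (Max (Gamma2 m)))) =
        real m / 44 * (- 5 * t m + 36 * t (m - 1) - 7 * t (m - 2))
        + 1 / 22 * (- 8 * t m - 69 * t (m - 1) + 59 * t (m - 2)) + (real m + 10) / 4
    \<and> real (num_squares (nat (Max (Gamma1 m)))) =
        real m / 44 * (3 * t m + 18 * t (m - 1) + 13 * t (m - 2))
        + 1 / 44 * (3 * t m - 102 * t (m - 1) - 51 * t (m - 2)) + (real m + 9) / 4"
proof -
  define i where "i = m - 3"
  have m: "m = Suc (Suc (Suc i))" using assms by (simp add: i_def)
  define x where x: "x = real (trib i)"
  define y where y: "y = real (trib (Suc i))"
  define z where z: "z = real (trib (Suc (Suc i)))"
  note xyz = x y z
  have t: "real (trib m) = z + y + x" "real (trib (m - 1)) = z" "real (trib (m - 2)) = y"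
    "real (trib (Suc m)) = 2 * z + 2 * y + x" "real (trib (Suc (Suc m))) = 4 * z + 3 * y + 2 * x"
    using trib_Suc3[of i] trib_Suc3[of "Suc i"] trib_Suc3[of "Suc (Suc i)"] by (simp_all add: m xyz)
  have counts: "count La 2 = 1" "count Lb 2 = 1" "count Lc 2 = 0"
    "count La 4 = 2" "count Lb 4 = 1" "count Lc 4 = 1"
  proof -
    have 3: "T 3 = Lc" using T_phi_1[of 1] T_1 phi_Suc[of 0] T_0 by (simp add: numeral_3_eq_3)
    show "count La 2 = 1" "count Lb 2 = 1" "count Lc 2 = 0"
      "count La 4 = 2" "count Lb 4 = 1" "count Lc 4 = 1"
      using T_2 3 by (simp_all add: count_Suc eval_nat_numeral T_0 T_1)
  qed
  have 1: "44 * real (num_squares (nat (Max (Gamma1 m)))) =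
      m * (3 * (z + y + x) + 18 * z + 13 * y) + (3 * (z + y + x) - 102 * z - 51 * y) + 11 * (m + 9)"
  proof -
    have "h m < 2 * trib (Suc m)" using h_less_trib[of m] by simp
    then have "num_squares (nat (Max (Gamma1 m))) = squares_upto_level m 0"
      using num_squares_level[of m 0] assms by (simp add: Max_Gamma)
    \<comment> \<open>For \<open>s = 0\<close> all letter counts vanish and only the constant part
      of the closed form is left.\<close>
    then show ?thesis using squares_upto_level_closed[of m 0] t
      by (simp add: algebra_simps)
  qed
  have 2: "44 * real (num_squares (nat (Max (Gamma2 m)))) =
      m * (36 * z - 5 * (z + y + x) - 7 * y) + 2 * (59 * y - 8 * (z + y + x) - 69 * z) + 11 * (m + 10)"
  proof -
    have "trib (Suc (Suc i)) + h (Suc i) < 2 * trib (Suc (Suc i))" using h_less_trib[of "Suc i"] by simp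
    then have "num_squares (nat (Max (Gamma2 m))) = squares_upto_level (Suc i) 2"
      using num_squares_level[of "Suc i" 2] assms Max_Gamma(2)[of m]
      by (simp add: phi_pow_2 m del: funpow.simps)
    then show ?thesis using squares_upto_level_closed[of "Suc i" 2] t
      by (simp add: counts m xyz algebra_simps)
  qed
  have 3: "44 * real (num_squares (nat (Max (Gamma3 m)))) =
      m * (48 * z - 25 * (z + y + x) + 31 * y) + (173 * (z + y + x) - 294 * z - 213 * y) + 11 * (m + 11)"
  proof -
    have "num_squares (nat (Max (Gamma3 m))) = squares_upto_level i 4 + card (offs (Suc i) La)"
      using num_squares_level_4[of i] assms Max_Gamma(3)[of m] by (simp add: m del: offs.simps)
    then show ?thesis using squares_upto_level_closed[of i 4] two_card_offs(1)[of "Suc i"] t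
      by (simp add: counts m xyz algebra_simps del: offs.simps)
  qed
  show ?thesis
    unfolding Let_def t using 1 2 3 by (simp add: field_simps)
qed

end
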